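(* Let $G$ be a finite simple bipartite graph with $n$ vertices, $m$ edges and Laplacian eigenvalues $\mu_1,\dots,\mu_n$, and let $G^*$ be its extended double cover. Then $LE(G^* )=2\,LE(G)$ if and only if $\left|\mu_i-\frac{2m}{n}\right|\ge 1$ for all $1\le i\le n$.
   Context: Laplacian eigenvalues are the eigenvalues (with multiplicity) of $D-A$, with $A$ the adjacency matrix and $D$ the diagonal degree matrix. The Laplacian energy of a graph $H$ with $N$ vertices, $M$ edges and Laplacian eigenvalues $\nu_1,\dots,\nu_N$ is $LE(H)=\sum_{i=1}^N|\nu_i-\frac{2M}{N}|$. For $G$ with vertex set $\{v_1,\dots,v_n\}$, the extended double cover $G^*$ is the bipartite graph with parts $X=\{x_1,\dots,x_n\}$, $Y=\{y_1,\dots,y_n\}$, where $x_i$ is adjacent to $y_j$ iff $i=j$ or $v_i$ is adjacent to $v_j$ in $G$. *)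

theory Defs
  imports
    "Graph_Theory.Graph_Theory"
    "Jordan_Normal_Form.Char_Poly"
begin

section \<open>Graphs\<close>

text \<open>
  A finite simple graph is a \<^locale>\<open>pair_graph\<close> of the library: an edge between \<open>u\<close> and \<open>v\<close> is
  represented by the two arcs \<open>(u, v)\<close> and \<open>(v, u)\<close>.  Hence \<open>out_degree\<close> is the ordinary degree,
  while \<^term>\<open>parcs G\<close> has twice as many elements as there are edges; edges are therefore counted as
  unordered pairs.
\<close>

definition num_edges :: "'a pair_pre_digraph \<Rightarrow> nat" where
  "num_edges G = card {{u, v} | u v. (u, v) \<in> parcs G}"

definition bipartite :: "'a pair_pre_digraph \<Rightarrow> bool" where
  "bipartite G \<longleftrightarrow>
     (\<exists>X Y. X \<union> Y = pverts G \<and> X \<inter> Y = {} \<and> parcs G \<subseteq> X \<times> Y \<union> Y \<times> X)"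

text \<open>The copies \<open>x\<^sub>v\<close> and \<open>y\<^sub>v\<close> of a vertex \<open>v\<close> are \<^term>\<open>Inl v\<close> and \<^term>\<open>Inr v\<close>.\<close>

definition extended_double_cover :: "'a pair_pre_digraph \<Rightarrow> ('a + 'a) pair_pre_digraph" where
  "extended_double_cover G =
     (let E = {(Inl u, Inr v) | u v. u \<in> pverts G \<and> v \<in> pverts G \<and> (u = v \<or> (u, v) \<in> parcs G)}
      in \<lparr> pverts = Inl ` pverts G \<union> Inr ` pverts G, parcs = E \<union> E\<inverse> \<rparr>)"

section \<open>Laplacian matrix, spectrum and energy\<close>

text \<open>The matrices depend on an enumeration \<open>vs\<close> of the vertices.\<close>

definition adjacency_mat :: "'a list \<Rightarrow> 'a pair_pre_digraph \<Rightarrow> real mat" where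
  "adjacency_mat vs G =
     mat (length vs) (length vs) (\<lambda>(i, j). if (vs ! i, vs ! j) \<in> parcs G then 1 else 0)"

definition degree_mat :: "'a list \<Rightarrow> 'a pair_pre_digraph \<Rightarrow> real mat" where
  "degree_mat vs G =
     mat (length vs) (length vs)
       (\<lambda>(i, j). if i = j then real (out_degree (with_proj G) (vs ! i)) else 0)"

definition laplacian_mat :: "'a list \<Rightarrow> 'a pair_pre_digraph \<Rightarrow> real mat" where
  "laplacian_mat vs G = degree_mat vs G - adjacency_mat vs G"

definition vertex_list :: "'a pair_pre_digraph \<Rightarrow> 'a list" where
  "vertex_list G = (SOME vs. distinct vs \<and> set vs = pverts G)"

text \<open>
  The multiset of the Laplacian eigenvalues, repeated according to multiplicity.  It does not depend
  on the choice of the enumeration (\<open>laplacian_spectrum_eqI\<close>), and since the Laplacian matrix is real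
  symmetric, the real roots of its characteristic polynomial are all of its eigenvalues: there are as
  many as there are vertices (\<open>size_laplacian_spectrum\<close>).
\<close>

definition laplacian_spectrum :: "'a pair_pre_digraph \<Rightarrow> real multiset" where
  "laplacian_spectrum G = proots (char_poly (laplacian_mat (vertex_list G) G))"

definition laplacian_energy :: "'a pair_pre_digraph \<Rightarrow> real" where
  "laplacian_energy G =
     (\<Sum>\<nu>\<in>#laplacian_spectrum G. \<bar>\<nu> - 2 * real (num_edges G) / real (card (pverts G))\<bar>)"

section \<open>Well-definedness\<close>

lemma vertex_list:
  assumes "finite (pverts G)"
  shows "distinct (vertex_list G)" "set (vertex_list G) = pverts G"
proof -
  have "\<exists>vs. distinct vs \<and> set vs = pverts G"
    using finite_distinct_list[OF assms] by blast
  from someI_ex[OF this] show "distinct (vertex_list G)" "set (vertex_list G) = pverts G"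
    unfolding vertex_list_def by auto
qed

lemma pair_graph_extended_double_cover:
  assumes "pair_graph G"
  shows "pair_graph (extended_double_cover G)"
proof -
  interpret pair_graph G by fact
  have fin: "finite (pverts (extended_double_cover G))"
    by (simp add: extended_double_cover_def Let_def)
  have sub: "parcs (extended_double_cover G)
      \<subseteq> pverts (extended_double_cover G) \<times> pverts (extended_double_cover G)"
    by (auto simp: extended_double_cover_def Let_def)
  have "finite (parcs (extended_double_cover G))"
    using finite_subset[OF sub] fin by blast
  moreover have "sym (parcs (extended_double_cover G))"
    unfolding extended_double_cover_def Let_def by (rule symI) auto
  ultimately show ?thesis
    using fin sub
    by unfold_locales (auto simp: symmetric_def, auto simp: extended_double_cover_def Let_def)
qed

lemma bipartite_extended_double_cover: "bipartite (extended_double_cover G)"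
  unfolding bipartite_def
  by (rule exI[of _ "Inl ` pverts G"], rule exI[of _ "Inr ` pverts G"])
    (auto simp: extended_double_cover_def Let_def)

lemma laplacian_mat_carrier:
  "laplacian_mat vs G \<in> carrier_mat (length vs) (length vs)"
  unfolding laplacian_mat_def degree_mat_def adjacency_mat_def
  by (intro minus_carrier_mat) auto

lemma laplacian_mat_index:
  assumes "i < length vs" "j < length vs"
  shows "laplacian_mat vs G $$ (i, j) =
    (if i = j then real (out_degree (with_proj G) (vs ! i)) else 0)
      - (if (vs ! i, vs ! j) \<in> parcs G then 1 else 0)"
  using assms by (simp add: laplacian_mat_def degree_mat_def adjacency_mat_def)

lemma char_poly_laplacian_mat_cong:
  assumes vs: "distinct vs" and ws: "distinct ws" and eq: "set vs = set ws"
  shows "char_poly (laplacian_mat vs G) = char_poly (laplacian_mat ws G)"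
proof -
  define n where "n = length vs"
  have n': "length ws = n"
    using distinct_card[OF vs] distinct_card[OF ws] eq by (simp add: n_def)
  have "mset ws = mset vs"
    using vs ws eq by (metis set_eq_iff_mset_eq_distinct)
  then obtain p where p: "p permutes {..<n}" and wsp: "permute_list p vs = ws"
    unfolding n_def by (metis mset_eq_permutation)
  have p0: "p permutes {0..<n}" using p by (simp add: atLeast0LessThan)
  have pn: "p i < n" if "i < n" for i using permutes_in_image[OF p, of i] that by simp
  have ws_nth: "ws ! i = vs ! p i" if "i < n" for i
    using permute_list_nth[of p vs i] p that wsp by (simp add: n_def)
  have pinj: "p i = p j \<longleftrightarrow> i = j" for i j
    using permutes_inj[OF p] by (simp add: inj_eq)
  let ?A = "char_poly_matrix (laplacian_mat vs G)"
  let ?B = "char_poly_matrix (laplacian_mat ws G)"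
  let ?C = "mat n n (\<lambda>(i, j). ?A $$ (p i, j))"
  have L: "laplacian_mat vs G \<in> carrier_mat n n" "laplacian_mat ws G \<in> carrier_mat n n"
    using laplacian_mat_carrier[of vs G] laplacian_mat_carrier[of ws G] n' by (auto simp: n_def)
  have A: "?A \<in> carrier_mat n n" and B: "?B \<in> carrier_mat n n" using L by auto
  have Cc: "?C \<in> carrier_mat n n" by simp
  have ent: "?B $$ (i, j) = ?A $$ (p i, p j)" if "i < n" "j < n" for i j
  proof -
    have l: "laplacian_mat ws G $$ (i, j) = laplacian_mat vs G $$ (p i, p j)"
      using that pn n'
      by (simp add: laplacian_mat_index n_def[symmetric] ws_nth pinj)
    have "dim_row (laplacian_mat vs G) = n" "dim_col (laplacian_mat vs G) = n"
      "dim_row (laplacian_mat ws G) = n" "dim_col (laplacian_mat ws G) = n"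
      using L by auto
    then show ?thesis using that pn by (simp add: char_poly_matrix_def l pinj)
  qed
  have BT: "transpose_mat ?B = mat n n (\<lambda>(i, j). transpose_mat ?C $$ (p i, j))"
    using B pn by (intro eq_matI) (auto simp: ent)
  have "det ?B = det (transpose_mat ?B)" using det_transpose[OF B] by simp
  also have "\<dots> = signof p * det (transpose_mat ?C)"
    unfolding BT by (rule det_permute_rows[OF _ p0]) simp
  also have "\<dots> = signof p * det ?C" using det_transpose[OF Cc] by simp
  also have "\<dots> = signof p * (signof p * det ?A)" by (subst det_permute_rows[OF A p0]) simp
  also have "\<dots> = det ?A"
    by (cases "sign p = 1") (auto simp: sign_def)
  finally show ?thesis by (simp add: char_poly_def)
qed

lemma laplacian_spectrum_eqI:
  assumes "distinct vs" "set vs = pverts G"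
  shows "laplacian_spectrum G = proots (char_poly (laplacian_mat vs G))"
proof -
  have "finite (pverts G)" using assms(2) finite_set[of vs] by simp
  with char_poly_laplacian_mat_cong[of vs "vertex_list G" G] vertex_list[of G] assms
  show ?thesis by (simp add: laplacian_spectrum_def)
qed

lemma real_symmetric_eigenvalue_real:
  fixes A :: "real mat"
  assumes A: "A \<in> carrier_mat n n"
    and sym: "\<And>i j. i < n \<Longrightarrow> j < n \<Longrightarrow> A $$ (i, j) = A $$ (j, i)"
    and ev: "eigenvalue (map_mat complex_of_real A) k"
  shows "k \<in> \<real>"
proof -
  let ?A = "map_mat complex_of_real A"
  from ev A obtain v where v: "v \<in> carrier_vec n" "v \<noteq> 0\<^sub>v n" and Av: "?A *\<^sub>v v = k \<cdot>\<^sub>v v"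
    by (auto simp: eigenvalue_def eigenvector_def)
  define S where "S = (\<Sum>i<n. (cmod (v $ i))\<^sup>2)"
  define T where "T = (\<Sum>i<n. \<Sum>j<n. cnj (v $ i) * complex_of_real (A $$ (i, j)) * v $ j)"
  have row: "(\<Sum>j<n. complex_of_real (A $$ (i, j)) * v $ j) = k * v $ i" if "i < n" for i
  proof -
    have "(?A *\<^sub>v v) $ i = (\<Sum>j<n. complex_of_real (A $$ (i, j)) * v $ j)"
      using A v that by (auto simp: scalar_prod_def atLeast0LessThan intro!: sum.cong)
    then show ?thesis using Av v that by simp
  qed
  have "T = (\<Sum>i<n. cnj (v $ i) * (k * v $ i))"
    unfolding T_def by (rule sum.cong) (auto simp: row[symmetric] sum_distrib_left mult.assoc)
  also have "\<dots> = k * complex_of_real S"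
    unfolding S_def of_real_sum sum_distrib_left
    by (rule sum.cong) (auto simp: complex_norm_square[symmetric] mult.commute mult.left_commute)
  finally have T: "T = k * complex_of_real S" .
  have "cnj T = (\<Sum>i<n. \<Sum>j<n. cnj (v $ j) * complex_of_real (A $$ (i, j)) * v $ i)"
    unfolding T_def by (simp add: mult.commute mult.left_commute)
  also have "\<dots> = (\<Sum>j<n. \<Sum>i<n. cnj (v $ j) * complex_of_real (A $$ (i, j)) * v $ i)"
    by (rule sum.swap)
  also have "\<dots> = T"
    unfolding T_def by (intro sum.cong refl) (metis lessThan_iff sym)
  finally have "cnj T = T" .
  then have *: "cnj k * complex_of_real S = k * complex_of_real S" by (simp add: T)
  obtain i where i: "i < n" "v $ i \<noteq> 0" using v by (metis carrier_vecD eq_vecI index_zero_vec)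
  have "S > 0" unfolding S_def by (rule sum_pos2[of _ i]) (use i in auto)
  with * have "cnj k = k" by simp
  then show ?thesis by (simp add: Reals_cnj_iff)
qed

lemma size_laplacian_spectrum:
  assumes "pair_graph G"
  shows "size (laplacian_spectrum G) = card (pverts G)"
proof -
  interpret pair_graph G by fact
  let ?vs = "vertex_list G"
  define n where "n = length ?vs"
  let ?L = "laplacian_mat ?vs G"
  let ?C = "map_mat complex_of_real ?L"
  have n: "n = card (pverts G)"
    using vertex_list[OF pair_finite_verts] by (metis n_def distinct_card)
  have L: "?L \<in> carrier_mat n n" using laplacian_mat_carrier by (simp add: n_def)
  then have C: "?C \<in> carrier_mat n n" by simp
  have arc_sym: "(u, v) \<in> parcs G \<longleftrightarrow> (v, u) \<in> parcs G" for u v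
    using sym_arcs by (auto simp: symmetric_def sym_def)
  have sym: "?L $$ (i, j) = ?L $$ (j, i)" if "i < n" "j < n" for i j
    using that arc_sym by (simp add: laplacian_mat_index n_def)
  from char_poly_factorized[OF C] obtain as where
    as: "char_poly ?C = (\<Prod>a\<leftarrow>as. [:- a, 1:])" and len: "length as = n" by auto
  have real: "a \<in> \<real>" if "a \<in> set as" for a
  proof (rule real_symmetric_eigenvalue_real[OF L sym])
    show "eigenvalue ?C a"
      unfolding eigenvalue_root_char_poly[OF C] as poly_prod_list
      using that by (auto simp: prod_list_zero_iff image_iff intro!: bexI[of _ a])
  qed
  interpret h: map_poly_inj_idom_hom complex_of_real ..
  have "map_poly complex_of_real (char_poly ?L) = char_poly ?C"
    using of_real_hom.char_poly_hom[OF L, where ?'a = complex] by simp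
  also have "\<dots> = (\<Prod>a\<leftarrow>as. map_poly complex_of_real [:- Re a, 1:])"
    unfolding as using real
    by (intro arg_cong[of _ _ prod_list] map_cong refl) (auto simp: map_poly_pCons elim!: Reals_cases)
  also have "\<dots> = map_poly complex_of_real (\<Prod>a\<leftarrow>as. [:- Re a, 1:])"
    by (induction as) (simp_all add: h.hom_mult del: mult_pCons_left map_poly_pCons)
  finally have "char_poly ?L = (\<Prod>a\<leftarrow>as. [:- Re a, 1:])"
    by (rule h.injectivity)
  then have "laplacian_spectrum G = proots (\<Prod>a\<leftarrow>as. [:- Re a, 1:])"
    by (simp add: laplacian_spectrum_def)
  also have "\<dots> = image_mset Re (mset as)"
  proof (induction as)
    case (Cons a as)
    have "(\<Prod>a\<leftarrow>as. [:- Re a, 1:]) \<noteq> 0" by (auto simp: prod_list_zero_iff)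
    then have "proots ([:- Re a, 1:] * (\<Prod>a\<leftarrow>as. [:- Re a, 1:]))
        = proots [:- Re a, 1:] + proots (\<Prod>a\<leftarrow>as. [:- Re a, 1:])"
      by (intro proots_mult) auto
    with Cons.IH show ?case by (simp del: mult_pCons_left)
  qed simp
  finally show ?thesis by (simp add: len n)
qed

end

theory Submission
  imports Defs
begin

text \<open>
  Write \<open>A\<close> for the adjacency matrix and \<open>D\<close> for the degree matrix of \<open>G\<close>.  Listing the vertices
  \<open>x\<^sub>v\<close> of the extended double cover before the vertices \<open>y\<^sub>v\<close>, its Laplacian matrix has diagonal
  blocks \<open>D + I\<close> and off-diagonal blocks \<open>- (A + I)\<close>.  Passing to the sum and the difference of the
  two halves of a vector splits such a matrix, so the spectrum is that of \<open>D - A\<close> together with that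
  of \<open>D + A + 2 I\<close>.  This part is valid for every graph.  For bipartite \<open>G\<close>, changing the sign
  of the coordinates in one colour class turns \<open>D + A\<close> into \<open>D - A\<close>; hence the spectrum consists of
  the numbers \<open>\<mu>\<close> and \<open>\<mu> + 2\<close>, for \<open>\<mu>\<close> in the Laplacian spectrum of \<open>G\<close>
  (\<open>laplacian_spectrum_extended_double_cover\<close>).

  Each degree grows by one, so the mean degree \<open>c = 2 m / n\<close> becomes \<open>c + 1\<close>.  Relative to the new
  mean, the pair \<open>\<mu>, \<mu> + 2\<close> lies symmetrically around \<open>\<mu> - c\<close>, at distance one on either side, and
  \<open>\<bar>\<mu> - c - 1\<bar> + \<bar>\<mu> - c + 1\<bar> = 2 * max 1 \<bar>\<mu> - c\<bar>\<close>.
  The energy of the double cover is therefore twice the sum of \<open>max 1 \<bar>\<mu> - c\<bar>\<close>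
  (\<open>laplacian_energy_extended_double_cover\<close>).  This dominates twice the sum of \<open>\<bar>\<mu> - c\<bar>\<close> term by
  term, with equality exactly if no term is below one.
\<close>

section \<open>Determinants and characteristic polynomials\<close>

text \<open>
  Adding the second block column to the first and then subtracting the first block row from the
  second makes the matrix block triangular; both operations are multiplications by unitriangular
  matrices.
\<close>

lemma det_four_block_mat_symmetric_blocks:
  fixes P Q :: "'a :: idom mat"
  assumes P: "P \<in> carrier_mat n n" and Q: "Q \<in> carrier_mat n n"
  shows "det (four_block_mat P Q Q P) = det (P + Q) * det (P - Q)"
proof -
  let ?M = "four_block_mat P Q Q P"
  let ?R = "four_block_mat (1\<^sub>m n) (0\<^sub>m n n) (1\<^sub>m n) (1\<^sub>m n) :: 'a mat"
  let ?L = "four_block_mat (1\<^sub>m n) (0\<^sub>m n n) (- 1\<^sub>m n) (1\<^sub>m n) :: 'a mat"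
  have M: "?M \<in> carrier_mat (n + n) (n + n)" using P by simp
  have L: "?L \<in> carrier_mat (n + n) (n + n)" and R: "?R \<in> carrier_mat (n + n) (n + n)"
    by simp_all
  have dL: "det ?L = 1" and dR: "det ?R = 1"
    by (simp_all add: det_four_block_mat_upper_right_zero[of _ n _ n])
  have "?M * ?R = four_block_mat (P + Q) Q (Q + P) P"
    using P Q by (subst mult_four_block_mat[of _ n n _ n _ n _ _ n _ n]) auto
  also have "?L * \<dots> = four_block_mat (P + Q) Q (0\<^sub>m n n) (P - Q)"
    using P Q
    by (subst mult_four_block_mat[of _ n n _ n _ n _ _ n _ n])
      (auto intro!: cong_four_block_mat eq_matI)
  finally have eq: "?L * (?M * ?R) = four_block_mat (P + Q) Q (0\<^sub>m n n) (P - Q)" .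
  have "det ?M = det (?L * (?M * ?R))"
    using det_mult[OF L mult_carrier_mat[OF M R]] det_mult[OF M R] dL dR by simp
  also have "\<dots> = det (P + Q) * det (P - Q)"
    unfolding eq using P Q
    by (intro det_four_block_mat_lower_left_zero[of _ n _ n]) auto
  finally show ?thesis .
qed

lemma char_poly_four_block_mat_symmetric_blocks:
  fixes P Q :: "'a :: idom mat"
  assumes P: "P \<in> carrier_mat n n" and Q: "Q \<in> carrier_mat n n"
  shows "char_poly (four_block_mat P Q Q P) = char_poly (P + Q) * char_poly (P - Q)"
proof -
  let ?N = "map_mat (\<lambda>a. [:- a:]) Q"
  have "char_poly_matrix (four_block_mat P Q Q P) =
      four_block_mat (char_poly_matrix P) ?N ?N (char_poly_matrix P)"
    using P Q by (intro eq_matI) (auto simp: char_poly_matrix_def one_poly_def)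
  moreover have "char_poly_matrix P + ?N = char_poly_matrix (P + Q)"
    using P Q by (intro eq_matI) (auto simp: char_poly_matrix_def)
  moreover have "char_poly_matrix P - ?N = char_poly_matrix (P - Q)"
    using P Q by (intro eq_matI) (auto simp: char_poly_matrix_def)
  ultimately show ?thesis
    using P Q by (simp add: char_poly_def det_four_block_mat_symmetric_blocks[of _ n])
qed

text \<open>A diagonal matrix of signs is its own inverse, so conjugating by it is a similarity.\<close>

lemma char_poly_sign_conjugate:
  fixes A B :: "'a :: comm_ring_1 mat"
  assumes A: "A \<in> carrier_mat n n" and B: "B \<in> carrier_mat n n"
    and sign: "\<And>i. i < n \<Longrightarrow> s i * s i = 1"
    and ent: "\<And>i j. i < n \<Longrightarrow> j < n \<Longrightarrow> A $$ (i, j) = s i * B $$ (i, j) * s j"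
  shows "char_poly A = char_poly B"
proof (rule char_poly_similar, rule similar_matI)
  let ?S = "mat_diag n s"
  show "{A, B, ?S, ?S} \<subseteq> carrier_mat n n" using A B by simp
  show "?S * ?S = 1\<^sub>m n" "?S * ?S = 1\<^sub>m n"
    unfolding mat_diag_diag using sign by (auto simp: mat_diag_def intro!: eq_matI)
  show "A = ?S * B * ?S"
    using A B
    by (subst mat_diag_mult_left[OF B], subst mat_diag_mult_right[of _ n])
      (auto simp: ent intro!: eq_matI)
qed

lemma char_poly_add_scalar:
  fixes A :: "'a :: field_char_0 mat"
  assumes A: "A \<in> carrier_mat n n"
  shows "char_poly (A + c \<cdot>\<^sub>m 1\<^sub>m n) = char_poly A \<circ>\<^sub>p [:- c, 1:]"
proof -
  have "poly (char_poly (A + c \<cdot>\<^sub>m 1\<^sub>m n)) x = poly (char_poly A \<circ>\<^sub>p [:- c, 1:]) x" for x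
  proof -
    have "- char_matrix (A + c \<cdot>\<^sub>m 1\<^sub>m n) x = - char_matrix A (x - c)"
      using A by (intro eq_matI) (auto simp: char_matrix_def)
    then show ?thesis
      using A by (simp add: poly_pcompose char_poly_matrix[of _ n])
  qed
  then show ?thesis by (simp add: poly_eq_poly_eq_iff[symmetric] fun_eq_iff)
qed

lemma proots_pcompose_shift:
  fixes p :: "'a :: field poly"
  assumes "p \<noteq> 0"
  shows "proots (p \<circ>\<^sub>p [:- c, 1:]) = image_mset ((+) c) (proots p)"
proof (rule multiset_eqI)
  fix x
  obtain q where q: "p = [:- (x - c), 1:] ^ order (x - c) p * q" "\<not> [:- (x - c), 1:] dvd q"
    using order_decomp[OF assms] by blast
  have ne: "p \<circ>\<^sub>p [:- c, 1:] \<noteq> 0"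
    using assms by (simp add: pcompose_eq_0_iff)
  have pow: "(r ^ k) \<circ>\<^sub>p t = (r \<circ>\<^sub>p t) ^ k" for r t :: "'a poly" and k
    by (induction k) (simp_all add: pcompose_mult pcompose_1)
  have eq: "p \<circ>\<^sub>p [:- c, 1:] = [:- x, 1:] ^ order (x - c) p * (q \<circ>\<^sub>p [:- c, 1:])"
    by (subst q(1)) (simp add: pcompose_mult pow pcompose_pCons)
  have "poly (q \<circ>\<^sub>p [:- c, 1:]) x \<noteq> 0"
    using q(2) by (simp add: poly_pcompose poly_eq_0_iff_dvd)
  then have "order x (q \<circ>\<^sub>p [:- c, 1:]) = 0" by (rule order_0I)
  then have "order x (p \<circ>\<^sub>p [:- c, 1:]) = order (x - c) p"
    using ne unfolding eq by (simp add: order_mult order_power_n_n)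
  moreover have "count (image_mset ((+) c) M) x = count M (x - c)" for M
    by (induction M) auto
  ultimately show "count (proots (p \<circ>\<^sub>p [:- c, 1:])) x = count (image_mset ((+) c) (proots p)) x"
    using ne assms by simp
qed

section \<open>Degrees and edges of the double cover\<close>

lemma out_degree_with_proj: "out_degree (with_proj G) v = card {w. (v, w) \<in> parcs G}"
proof -
  have "out_arcs (with_proj G) v = Pair v ` {w. (v, w) \<in> parcs G}"
    by (auto simp: out_arcs_def with_proj_def)
  then show ?thesis
    unfolding out_degree_def by (simp add: card_image inj_on_def)
qed

text \<open>
  A bipartition orients each edge from \<open>X\<close> to \<open>Y\<close>.  This replaces unordered pairs by the ordered pairs
  in \<open>A\<close>, which are easier to count; it serves both for a bipartite \<open>G\<close> and for its double cover.
\<close>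

lemma num_edges_oriented:
  assumes A: "A \<subseteq> X \<times> Y" "X \<inter> Y = {}" "finite A" and parcs: "parcs G = A \<union> A\<inverse>"
  shows "num_edges G = card A" "card (parcs G) = 2 * card A"
proof -
  have "{{u, v} | u v. (u, v) \<in> parcs G} = (\<lambda>(u, v). {u, v}) ` A"
    unfolding parcs by (auto simp: insert_commute image_iff)
  moreover have "inj_on (\<lambda>(u, v). {u, v}) A"
    using A(1,2) by (fastforce simp: inj_on_def doubleton_eq_iff)
  ultimately show "num_edges G = card A"
    by (simp add: num_edges_def card_image)
  have "A \<inter> A\<inverse> = {}" using A(1,2) by blast
  then show "card (parcs G) = 2 * card A"
    using A(3) by (simp add: parcs card_Un_disjoint)
qed

text \<open>
  The arcs from the first copy to the second correspond to the arcs of \<open>G\<close>, two for each edge, and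
  to the vertices of \<open>G\<close>.
\<close>

lemma num_edges_extended_double_cover:
  fixes G :: "'a pair_pre_digraph"
  assumes "pair_graph G" "bipartite G"
  shows "num_edges (extended_double_cover G) = 2 * num_edges G + card (pverts G)"
proof -
  interpret pair_graph G by fact
  let ?R = "parcs G \<union> Id_on (pverts G)"
  have fin: "finite (parcs G)" by simp
  have sub: "parcs G \<subseteq> pverts G \<times> pverts G"
    using in_arcsD1 in_arcsD2 by fastforce
  have finI: "finite (Id_on (pverts G))" and cardI: "card (Id_on (pverts G)) = card (pverts G)"
  proof -
    have "Id_on (pverts G) = (\<lambda>v. (v, v)) ` pverts G" by (auto simp: Id_on_def)
    then show "finite (Id_on (pverts G))" "card (Id_on (pverts G)) = card (pverts G)"
      by (simp_all add: card_image inj_on_def)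
  qed
  have no_loop: "parcs G \<inter> Id_on (pverts G) = {}"
    using no_loops' by (auto simp: Id_on_def)
  obtain X Y where XY: "X \<inter> Y = {}" "parcs G \<subseteq> X \<times> Y \<union> Y \<times> X"
    using assms(2) by (auto simp: bipartite_def)
  have "sym (parcs G)" using sym_arcs by (simp add: symmetric_def)
  then have "parcs G = (parcs G \<inter> X \<times> Y) \<union> (parcs G \<inter> X \<times> Y)\<inverse>"
    using XY by (auto simp: sym_def)
  from num_edges_oriented[OF _ XY(1) _ this] fin
  have G: "card (parcs G) = 2 * num_edges G" by simp
  define E :: "('a + 'a) rel" where "E = map_prod Inl Inr ` ?R"
  have "E = {(Inl u, Inr v) | u v. u \<in> pverts G \<and> v \<in> pverts G \<and> (u = v \<or> (u, v) \<in> parcs G)}"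
    using sub unfolding E_def by (auto simp: Id_on_def image_iff)
  then have parcs_E: "parcs (extended_double_cover G) = E \<union> E\<inverse>"
    by (simp add: extended_double_cover_def Let_def)
  have "num_edges (extended_double_cover G) = card E"
  proof (rule num_edges_oriented(1)[OF _ _ _ parcs_E])
    show "E \<subseteq> range Inl \<times> range Inr" by (auto simp: E_def)
    show "range Inl \<inter> range Inr = {}" by auto
    show "finite E" using fin finI by (simp add: E_def)
  qed
  also have "\<dots> = card ?R"
    unfolding E_def by (rule card_image) (auto simp: inj_on_def)
  also have "\<dots> = card (parcs G) + card (Id_on (pverts G))"
    using no_loop fin finI by (intro card_Un_disjoint) auto
  finally show ?thesis using G cardI by simp
qed

lemma out_degree_extended_double_cover:
  assumes "pair_graph G" "v \<in> pverts G"
  shows "out_degree (with_proj (extended_double_cover G)) (Inl v) = Suc (out_degree (with_proj G) v)"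
    and "out_degree (with_proj (extended_double_cover G)) (Inr v) = Suc (out_degree (with_proj G) v)"
proof -
  interpret pair_graph G by fact
  let ?N = "{w. (v, w) \<in> parcs G}"
  have N: "?N \<subseteq> pverts G" using in_arcsD2 by fastforce
  then have fin: "finite ?N" by (rule finite_subset) simp
  have v: "v \<notin> ?N" using no_loops' by blast
  have sym: "(u, w) \<in> parcs G \<longleftrightarrow> (w, u) \<in> parcs G" for u w
    using sym_arcs by (auto simp: symmetric_def sym_def)
  have "{w. (Inl v, w) \<in> parcs (extended_double_cover G)} = Inr ` insert v ?N"
    using assms(2) N by (auto simp: extended_double_cover_def Let_def)
  then show "out_degree (with_proj (extended_double_cover G)) (Inl v) = Suc (out_degree (with_proj G) v)"
    using fin v by (simp add: out_degree_with_proj card_image inj_on_def del: image_insert)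
  have "{w. (Inr v, w) \<in> parcs (extended_double_cover G)} = Inl ` insert v ?N"
    using assms(2) N sym by (auto simp: extended_double_cover_def Let_def)
  then show "out_degree (with_proj (extended_double_cover G)) (Inr v) = Suc (out_degree (with_proj G) v)"
    using fin v by (simp add: out_degree_with_proj card_image inj_on_def del: image_insert)
qed

section \<open>The Laplacian spectrum of the double cover\<close>

definition signless_laplacian_mat :: "'a list \<Rightarrow> 'a pair_pre_digraph \<Rightarrow> real mat" where
  "signless_laplacian_mat vs G = degree_mat vs G + adjacency_mat vs G"

lemma signless_laplacian_mat_carrier:
  "signless_laplacian_mat vs G \<in> carrier_mat (length vs) (length vs)"
  unfolding signless_laplacian_mat_def degree_mat_def adjacency_mat_def by simp

text \<open>
  Every nonzero off-diagonal entry joins two colour classes, so giving one class the sign \<open>- 1\<close>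
  negates the adjacency matrix and leaves the degree matrix unchanged.
\<close>

lemma char_poly_signless_laplacian_bipartite:
  assumes "bipartite G" "distinct vs" "set vs = pverts G"
  shows "char_poly (signless_laplacian_mat vs G) = char_poly (laplacian_mat vs G)"
proof -
  obtain X Y where XY: "X \<union> Y = pverts G" "X \<inter> Y = {}" "parcs G \<subseteq> X \<times> Y \<union> Y \<times> X"
    using assms(1) by (auto simp: bipartite_def)
  define s :: "nat \<Rightarrow> real" where "s i = (if vs ! i \<in> X then 1 else - 1)" for i
  show ?thesis
  proof (rule char_poly_sign_conjugate[OF signless_laplacian_mat_carrier laplacian_mat_carrier])
    fix i assume "i < length vs"
    then show "s i * s i = 1" by (simp add: s_def)
  next
    fix i j assume ij: "i < length vs" "j < length vs"
    have "(vs ! i \<in> X) \<noteq> (vs ! j \<in> X)" if "(vs ! i, vs ! j) \<in> parcs G"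
      using that XY by auto
    then show
      "signless_laplacian_mat vs G $$ (i, j) = s i * laplacian_mat vs G $$ (i, j) * s j"
      using ij
      by (auto simp: laplacian_mat_index signless_laplacian_mat_def degree_mat_def
          adjacency_mat_def s_def)
  qed
qed

lemma laplacian_mat_extended_double_cover:
  fixes G :: "'a pair_pre_digraph" and vs :: "'a list"
  defines "n \<equiv> length vs"
  defines "P \<equiv> degree_mat vs G + 1\<^sub>m n" and "Q \<equiv> - (adjacency_mat vs G + 1\<^sub>m n)"
  assumes G: "pair_graph G" and vs: "distinct vs" "set vs = pverts G"
  shows "laplacian_mat (map Inl vs @ map Inr vs) (extended_double_cover G) = four_block_mat P Q Q P"
proof (rule eq_matI)
  interpret pair_graph G by (fact G)
  have sym: "(u, w) \<in> parcs G \<longleftrightarrow> (w, u) \<in> parcs G" for u w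
    using sym_arcs by (auto simp: symmetric_def sym_def)
  have no_loop: "(u, u) \<notin> parcs G" for u using no_loops' by blast
  have P: "P \<in> carrier_mat n n" and Q: "Q \<in> carrier_mat n n"
    by (simp_all add: P_def Q_def n_def degree_mat_def adjacency_mat_def)
  let ?ws = "map Inl vs @ map Inr vs :: ('a + 'a) list"
  have C: "laplacian_mat ?ws (extended_double_cover G) \<in> carrier_mat (n + n) (n + n)"
    using laplacian_mat_carrier[of ?ws] by (simp add: n_def)
  show "dim_row (laplacian_mat ?ws (extended_double_cover G)) = dim_row (four_block_mat P Q Q P)"
    "dim_col (laplacian_mat ?ws (extended_double_cover G)) = dim_col (four_block_mat P Q Q P)"
    using P C by auto
  fix i j assume "i < dim_row (four_block_mat P Q Q P)" "j < dim_col (four_block_mat P Q Q P)"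
  then have ij: "i < n + n" "j < n + n" using P by auto
  have arc: "(Inl u, Inr w) \<in> parcs (extended_double_cover G) \<longleftrightarrow> u = w \<or> (u, w) \<in> parcs G"
    "(Inr u, Inl w) \<in> parcs (extended_double_cover G) \<longleftrightarrow> u = w \<or> (u, w) \<in> parcs G"
    if "u \<in> pverts G" "w \<in> pverts G" for u w
    using that sym by (auto simp: extended_double_cover_def Let_def)
  have no_arc: "(Inl u, Inl w) \<notin> parcs (extended_double_cover G)"
    "(Inr u, Inr w) \<notin> parcs (extended_double_cover G)" for u w
    by (auto simp: extended_double_cover_def Let_def)
  have mem: "vs ! k \<in> pverts G" if "k < n" for k
    using nth_mem[of k vs] that vs(2) by (simp add: n_def)
  have inj: "vs ! k = vs ! l \<longleftrightarrow> k = l" if "k < n" "l < n" for k l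
    using that vs(1) by (simp add: n_def nth_eq_iff_index_eq)
  show "laplacian_mat ?ws (extended_double_cover G) $$ (i, j) = four_block_mat P Q Q P $$ (i, j)"
  proof -
    have ws: "?ws ! k = (if k < n then Inl (vs ! k) else Inr (vs ! (k - n)))" if "k < n + n" for k
      using that by (auto simp: nth_append n_def)
    have L: "laplacian_mat ?ws (extended_double_cover G) $$ (i, j) =
      (if i = j then real (out_degree (with_proj (extended_double_cover G)) (?ws ! i)) else 0)
      - (if (?ws ! i, ?ws ! j) \<in> parcs (extended_double_cover G) then 1 else 0)"
      using ij by (intro laplacian_mat_index) (simp_all add: n_def)
    have Pent: "P $$ (k, l) = (if k = l then real (out_degree (with_proj G) (vs ! k)) + 1 else 0)"
      if "k < n" "l < n" for k l
      using that by (simp add: P_def degree_mat_def n_def)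
    have Qent: "Q $$ (k, l) = - (if k = l \<or> (vs ! k, vs ! l) \<in> parcs G then 1 else 0)"
      if "k < n" "l < n" for k l
      using that by (auto simp: Q_def adjacency_mat_def n_def no_loop)
    consider "i < n" "j < n" | "i < n" "\<not> j < n" | "\<not> i < n" "j < n" | "\<not> i < n" "\<not> j < n"
      by blast
    then show ?thesis
      using P Q ij
      by cases (auto simp: L ws Pent Qent no_arc arc mem inj
          out_degree_extended_double_cover[OF G])
  qed
qed

text \<open>
  Sum and difference of the blocks \<open>D + I\<close> and \<open>- (A + I)\<close> are \<open>D - A\<close> and \<open>D + A + 2 I\<close>.  The second
  has the spectrum of the signless Laplacian \<open>D + A\<close> shifted by two, which bipartiteness identifies
  with the shifted spectrum of \<open>D - A\<close>.
\<close>

theorem laplacian_spectrum_extended_double_cover: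
  assumes G: "pair_graph G" and bip: "bipartite G"
  shows "laplacian_spectrum (extended_double_cover G) =
    laplacian_spectrum G + image_mset ((+) 2) (laplacian_spectrum G)"
proof -
  interpret pair_graph G by fact
  define vs where "vs = vertex_list G"
  define n where "n = length vs"
  have vs: "distinct vs" "set vs = pverts G"
    using vertex_list[OF pair_finite_verts] by (simp_all add: vs_def)
  let ?ws = "map Inl vs @ map Inr vs :: ('a + 'a) list"
  let ?P = "degree_mat vs G + 1\<^sub>m n" and ?Q = "- (adjacency_mat vs G + 1\<^sub>m n)"
  let ?p = "char_poly (laplacian_mat vs G)"
  have D: "degree_mat vs G \<in> carrier_mat n n" and A: "adjacency_mat vs G \<in> carrier_mat n n"
    by (simp_all add: degree_mat_def adjacency_mat_def n_def)
  have sum: "?P + ?Q = laplacian_mat vs G"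
    using D A by (intro eq_matI) (auto simp: laplacian_mat_def)
  have diff: "?P - ?Q = signless_laplacian_mat vs G + 2 \<cdot>\<^sub>m 1\<^sub>m n"
    using D A by (intro eq_matI) (auto simp: signless_laplacian_mat_def)
  have "char_poly (laplacian_mat ?ws (extended_double_cover G)) =
      char_poly (?P + ?Q) * char_poly (?P - ?Q)"
    unfolding laplacian_mat_extended_double_cover[OF G vs, folded n_def]
    using D A by (intro char_poly_four_block_mat_symmetric_blocks[of _ n]) auto
  also have "\<dots> = ?p * (char_poly (signless_laplacian_mat vs G) \<circ>\<^sub>p [:- 2, 1:])"
    unfolding sum diff using signless_laplacian_mat_carrier[of vs G]
    by (simp add: char_poly_add_scalar n_def)
  also have "\<dots> = ?p * (?p \<circ>\<^sub>p [:- 2, 1:])"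
    by (simp add: char_poly_signless_laplacian_bipartite[OF bip vs])
  finally have cp: "char_poly (laplacian_mat ?ws (extended_double_cover G)) = ?p * (?p \<circ>\<^sub>p [:- 2, 1:])" .
  have p: "?p \<noteq> 0"
    using degree_monic_char_poly[OF laplacian_mat_carrier[of vs G]] by auto
  then have q: "?p \<circ>\<^sub>p [:- 2, 1:] \<noteq> 0" by (simp add: pcompose_eq_0_iff)
  have "distinct ?ws" "set ?ws = pverts (extended_double_cover G)"
    using vs by (auto simp: distinct_map extended_double_cover_def Let_def)
  from laplacian_spectrum_eqI[OF this]
  have "laplacian_spectrum (extended_double_cover G) = proots (?p * (?p \<circ>\<^sub>p [:- 2, 1:]))"
    by (simp only: cp)
  also have "\<dots> = proots ?p + image_mset ((+) 2) (proots ?p)"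
    using p q by (simp add: proots_mult proots_pcompose_shift)
  finally show ?thesis by (simp add: laplacian_spectrum_eqI[OF vs])
qed

section \<open>Laplacian energy\<close>

lemma sum_mset_eq_iff_pointwise:
  fixes f g :: "'a \<Rightarrow> 'b :: ordered_cancel_comm_monoid_add"
  assumes "\<And>x. x \<in># M \<Longrightarrow> f x \<le> g x"
  shows "(\<Sum>x\<in>#M. f x) = (\<Sum>x\<in>#M. g x) \<longleftrightarrow> (\<forall>x\<in>#M. f x = g x)"
  using assms
proof (induction M)
  case (add a M)
  then have "f a \<le> g a" "(\<Sum>x\<in>#M. f x) \<le> (\<Sum>x\<in>#M. g x)"
    by (auto intro: sum_mset_mono)
  then have "f a + (\<Sum>x\<in>#M. f x) = g a + (\<Sum>x\<in>#M. g x) \<longleftrightarrow>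
      f a = g a \<and> (\<Sum>x\<in>#M. f x) = (\<Sum>x\<in>#M. g x)"
    by (metis add_less_le_mono add_le_less_mono order_less_le)
  with add show ?case by simp
qed simp

lemma laplacian_energy_extended_double_cover:
  assumes G: "pair_graph G" and bip: "bipartite G"
  shows "laplacian_energy (extended_double_cover G) =
    2 * (\<Sum>\<mu>\<in>#laplacian_spectrum G. max 1 \<bar>\<mu> - 2 * real (num_edges G) / real (card (pverts G))\<bar>)"
proof -
  interpret pair_graph G by fact
  let ?n = "card (pverts G)"
  define c where "c = 2 * real (num_edges G) / real ?n"
  show ?thesis
  proof (cases "?n = 0")
    \<comment> \<open>The formula for the new mean degree needs a vertex; without one, both sums are empty.\<close>
    case True
    then have "laplacian_spectrum G = {#}" using size_laplacian_spectrum[OF G] by simp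
    then show ?thesis
      by (simp add: laplacian_energy_def laplacian_spectrum_extended_double_cover[OF assms])
  next
    case False
    have disj: "Inl ` A \<inter> Inr ` B = {}" for A B by auto
    have "card (pverts (extended_double_cover G)) = 2 * ?n"
      by (simp add: extended_double_cover_def Let_def card_Un_disjoint card_image
          disj)
    then have mean: "2 * real (num_edges (extended_double_cover G)) /
        real (card (pverts (extended_double_cover G))) = c + 1"
      using False by (simp add: num_edges_extended_double_cover[OF assms] c_def field_simps)
    have "laplacian_energy (extended_double_cover G) =
        (\<Sum>\<mu>\<in>#laplacian_spectrum G. \<bar>\<mu> - (c + 1)\<bar> + \<bar>2 + \<mu> - (c + 1)\<bar>)"
      unfolding laplacian_energy_def mean laplacian_spectrum_extended_double_cover[OF assms]
      by (simp add: image_mset.compositionality comp_def sum_mset.distrib)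
    also have "\<dots> = (\<Sum>\<mu>\<in>#laplacian_spectrum G. 2 * max 1 \<bar>\<mu> - c\<bar>)"
      by (intro arg_cong[of _ _ sum_mset] image_mset_cong) (auto simp: abs_if max_def)
    also have "\<dots> = 2 * (\<Sum>\<mu>\<in>#laplacian_spectrum G. max 1 \<bar>\<mu> - c\<bar>)"
      by (simp only: sum_mset_distrib_left image_mset.compositionality comp_def)
    finally show ?thesis by (simp add: c_def)
  qed
qed

theorem theorem4p2:
  fixes G :: "'a pair_pre_digraph"
  assumes "pair_graph G"
    and "bipartite G"
  shows "laplacian_energy (extended_double_cover G) = 2 * laplacian_energy G \<longleftrightarrow>
    (\<forall>\<mu>\<in>#laplacian_spectrum G. \<bar>\<mu> - 2 * real (num_edges G) / real (card (pverts G))\<bar> \<ge> 1)"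
proof -
  let ?x = "\<lambda>\<mu>. \<bar>\<mu> - 2 * real (num_edges G) / real (card (pverts G))\<bar>"
  have "laplacian_energy (extended_double_cover G) = 2 * laplacian_energy G \<longleftrightarrow>
      (\<Sum>\<mu>\<in>#laplacian_spectrum G. ?x \<mu>) = (\<Sum>\<mu>\<in>#laplacian_spectrum G. max 1 (?x \<mu>))"
    unfolding laplacian_energy_extended_double_cover[OF assms] laplacian_energy_def[of G] by linarith
  also have "\<dots> \<longleftrightarrow> (\<forall>\<mu>\<in>#laplacian_spectrum G. ?x \<mu> = max 1 (?x \<mu>))"
    by (rule sum_mset_eq_iff_pointwise) simp
  also have "\<dots> \<longleftrightarrow> (\<forall>\<mu>\<in>#laplacian_spectrum G. ?x \<mu> \<ge> 1)"
    by (auto simp: max_def)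
  finally show ?thesis .
qed

end
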